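(* Let $A\in\mathbf{Skew}_n$ have angles $\Theta=(\theta_1,\dots,\theta_m)\in\mathbb{R}^m$, and let $Q=\exp(A)$. Each of the linear maps $\mathcal{C}_\Theta:\mathbf{Skew}_n\to\mathbf{Skew}_n$ and $\mathrm{D}\exp(A):\mathbf{Skew}_n\to T_Q\mathcal{SO}_n$ is invertible if and only if $$\begin{cases}\theta_i\pm\theta_j\neq 2l\pi, & \forall\, j<i\le m,\ \forall\, l=\pm1,\pm2,\dots,\\ \theta_j\neq 2l\pi, & \forall\, j\le m,\ \forall\, l=\pm1,\pm2,\dots,\ \text{when } n=2m+1,\end{cases}$$ where the second line is imposed only if $n=2m+1$ is odd (if $n=2m$ only the first line is imposed), and in the first line both choices of sign are meant.
   Context: Let $n\ge 2$, $m=\lfloor n/2\rfloor$, $k=\lceil n/2\rceil$. $\mathbf{Skew}_n=\{A\in\mathbb{R}^{n\times n}:A+A^{T}=0\}$ and $\mathcal{SO}_n=\{Q\in\mathbb{R}^{n\times n}:Q^{T}Q=I_n,\det Q=1\}$; $\exp:\mathbf{Skew}_n\to\mathcal{SO}_n$ is the matrix exponential restricted to skew-symmetric matrices, and $\mathrm{D}\exp(A):\mathbf{Skew}_n\to T_Q\mathcal{SO}_n=\{QX:X\in\mathbf{Skew}_n\}$ is its derivative at $A$, where $Q=\exp(A)$. Angles: every $A\in\mathbf{Skew}_n$ has a real Schur decomposition $A=R\Xi R^{T}$ with $R$ real orthogonal and $\Xi$ block diagonal with $2\times2$ diagonal blocks $\begin{bmatrix}0&-\theta_i\\ \theta_i&0\end{bmatrix}$,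 $\theta_i\in\mathbb{R}$, $i=1,\dots,m$, followed by a $1\times1$ block $0$ if $n=2m+1$. The vector $\Theta=(\theta_1,\dots,\theta_m)$ is called the angles of $A$ (under $R$); negative angles are allowed. Core map: for $\Theta\in\mathbb{R}^m$ put $\lambda_{2i-1}=-\theta_i\imath$, $\lambda_{2i}=\theta_i\imath$ for $i\le m$, and $\lambda_n=0$ if $n=2m+1$ ($\imath$ is the imaginary unit). Let $\Phi\in\mathbb{C}^{n\times n}$ have entries $\phi_{pq}=(e^{\lambda_q-\lambda_p}-1)/(\lambda_q-\lambda_p)$ if $\lambda_p\ne\lambda_q$ and $\phi_{pq}=1$ if $\lambda_p=\lambda_q$. Let $U=\frac{\sqrt2}{2}\begin{bmatrix}1&1\\ \imath&-\imath\end{bmatrix}$ and let $U_n=\mathrm{diag}(U,\dots,U)$ ($m$ copies) if $n=2m$, $U_n=\mathrm{diag}(U,\dots,U,1)$ if $n=2m+1$. The core map is $\mathcal{C}_\Theta:\mathbf{Skew}_n\to\mathbf{Skew}_n$, $\mathcal{C}_\Theta(M)=U_n\big((U_n^{H}MU_n)\odot\Phi\big)U_n^{H}$, where $\odot$ is the entrywise (Hadamard) product and $^{H}$ the conjugate transpose. *)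

theory Defs
  imports "HOL-Analysis.Analysis"
begin

text \<open>An \<open>n \<times> n\<close> matrix is indexed by a finite linearly ordered type \<open>'n\<close> with \<open>n = CARD('n)\<close>;
  \<open>pos p\<close> is the 1-based position of the index \<open>p\<close>, so \<open>pos\<close> enumerates \<open>'n\<close> as \<open>1, \<dots>, n\<close>.\<close>

definition pos :: "'n::{finite,linorder} \<Rightarrow> nat" where
  "pos p = card {q. q \<le> p}"

lemma bij_betw_pos: "bij_betw pos (UNIV :: 'n::{finite,linorder} set) {1..CARD('n)}"
proof -
  have mono: "pos p < pos q" if "p < q" for p q :: 'n
    proof -
    have "{r. r \<le> p} \<subset> {r. r \<le> q}" using that by force
    then show ?thesis unfolding pos_def by (intro psubset_card_mono) auto
  qed
  have inj: "inj (pos :: 'n \<Rightarrow> nat)"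
    by (rule injI) (metis mono less_irrefl linorder_less_linear)
  have sub: "range (pos :: 'n \<Rightarrow> nat) \<subseteq> {1..CARD('n)}"
    by (auto simp: pos_def Suc_le_eq card_gt_0_iff intro!: card_mono)
  have "range (pos :: 'n \<Rightarrow> nat) = {1..CARD('n)}"
    by (rule card_subset_eq) (use sub inj in \<open>simp_all add: card_image\<close>)
  with inj show ?thesis by (simp add: bij_betw_def)
qed


definition Skew :: "(real^'n^'n) set" where
  "Skew = {A. A + transpose A = 0}"

definition tangent_SO :: "real^'n^'n \<Rightarrow> (real^'n^'n) set" where
  "tangent_SO Q = {Q ** X |X. X \<in> Skew}"

text \<open>The product on the type \<open>real^'n^'n\<close> is entrywise, so the library's \<open>power\<close> and \<open>exp\<close>
  do not give the matrix power and the matrix exponential.\<close>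

primrec mpow :: "real^'n^'n \<Rightarrow> nat \<Rightarrow> real^'n^'n" where
  "mpow A 0 = mat 1"
| "mpow A (Suc k) = A ** mpow A k"

definition mexp :: "real^'n^'n \<Rightarrow> real^'n^'n" where
  "mexp A = (\<Sum>k. (1 / fact k) *\<^sub>R mpow A k)"

text \<open>The derivative at \<open>A\<close> of the exponential restricted to \<open>Skew\<close>. Only its values on \<open>Skew\<close> are
  meaningful: there, any derivative within \<open>Skew\<close> is unique (\<open>Dexp_eqI\<close>).\<close>

definition Dexp :: "real^'n^'n \<Rightarrow> real^'n^'n \<Rightarrow> real^'n^'n" where
  "Dexp A = frechet_derivative mexp (at A within Skew)"

lemma Dexp_eqI:
  fixes A X :: "real^'n^'n"
  assumes D: "(mexp has_derivative D) (at A within Skew)" and A: "A \<in> Skew" and X: "X \<in> Skew"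
  shows "Dexp A X = D X"
proof -
  have "(mexp has_derivative Dexp A) (at A within Skew)"
    unfolding Dexp_def using D by (metis differentiableI frechet_derivative_works)
  moreover have "((\<lambda>t. mexp (A + t *\<^sub>R X)) has_derivative (\<lambda>t. E (t *\<^sub>R X))) (at 0)"
    if E: "(mexp has_derivative E) (at A within Skew)" for E
  proof -
    have line: "((\<lambda>t::real. A + t *\<^sub>R X) has_derivative (\<lambda>t. t *\<^sub>R X)) (at 0)"
      by (auto intro!: derivative_eq_intros)
    have "A + t *\<^sub>R X \<in> Skew" for t
    proof -
      have "A $ i $ j + A $ j $ i = 0" "X $ i $ j + X $ j $ i = 0" for i j
        using A X by (auto simp: Skew_def vec_eq_iff transpose_def)
      then have "(A $ i $ j + t * X $ i $ j) + (A $ j $ i + t * X $ j $ i) = 0" for i j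
        by (metis (no_types, lifting) add.assoc add.left_commute add.right_neutral
            distrib_left mult_zero_right)
      then show ?thesis
        by (simp add: Skew_def vec_eq_iff transpose_def)
    qed
    then have "range (\<lambda>t::real. A + t *\<^sub>R X) \<subseteq> Skew" by auto
    then have "(mexp has_derivative E) (at (A + 0 *\<^sub>R X) within range (\<lambda>t::real. A + t *\<^sub>R X))"
      using E by (auto intro: has_derivative_subset)
    from has_derivative_in_compose[OF line this] show ?thesis by simp
  qed
  ultimately have "(\<lambda>t::real. Dexp A (t *\<^sub>R X)) = (\<lambda>t. D (t *\<^sub>R X))"
    using D has_derivative_unique by blast
  from fun_cong[OF this, of 1] show ?thesis by simp
qed


text \<open>Angle vectors are functions \<open>\<Theta>\<close> on \<open>nat\<close> of which only \<open>\<Theta> 1, \<dots>, \<Theta> m\<close> with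
  \<open>m = CARD('n) div 2\<close> are ever used. For odd \<open>n\<close> the last row and column of \<open>schur_block \<Theta>\<close>
  vanish, because no index has position \<open>n + 1\<close>.\<close>

definition schur_block :: "(nat \<Rightarrow> real) \<Rightarrow> real^'n::{finite,linorder}^'n::{finite,linorder}" where
  "schur_block \<Theta> = (\<chi> p q.
     if odd (pos p) \<and> pos q = pos p + 1 then - \<Theta> ((pos p + 1) div 2)
     else if even (pos p) \<and> pos p = pos q + 1 then \<Theta> (pos p div 2)
     else 0)"

definition has_angles :: "real^'n::{finite,linorder}^'n::{finite,linorder} \<Rightarrow> (nat \<Rightarrow> real) \<Rightarrow> bool" where
  "has_angles A \<Theta> \<longleftrightarrow> (\<exists>R. orthogonal_matrix R \<and> A = R ** schur_block \<Theta> ** transpose R)"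


definition lam :: "(nat \<Rightarrow> real) \<Rightarrow> 'n::{finite,linorder} \<Rightarrow> complex" where
  "lam \<Theta> p =
     (if even (pos p) then \<i> * complex_of_real (\<Theta> (pos p div 2))
      else if pos p = CARD('n) then 0
      else - \<i> * complex_of_real (\<Theta> ((pos p + 1) div 2)))"

definition Phi :: "(nat \<Rightarrow> real) \<Rightarrow> complex^'n::{finite,linorder}^'n::{finite,linorder}" where
  "Phi \<Theta> = (\<chi> p q.
     if lam \<Theta> p = lam \<Theta> q then 1
     else (exp (lam \<Theta> q - lam \<Theta> p) - 1) / (lam \<Theta> q - lam \<Theta> p))"

text \<open>Block diagonal with blocks \<open>(1/\<surd>2) [1, 1; \<i>, -\<i>]\<close>, followed by a \<open>1\<close> if \<open>n\<close> is odd.\<close>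

definition Umat :: "complex^'n::{finite,linorder}^'n::{finite,linorder}" where
  "Umat = (\<chi> p q.
     if odd CARD('n) \<and> pos p = CARD('n) \<and> pos q = CARD('n) then 1
     else if (pos p + 1) div 2 \<noteq> (pos q + 1) div 2 then 0
     else complex_of_real (sqrt 2 / 2) *
       (if odd (pos p) then 1 else if odd (pos q) then \<i> else - \<i>))"

definition hermitian_transpose :: "complex^'n^'m \<Rightarrow> complex^'m^'n" where
  "hermitian_transpose M = map_matrix cnj (transpose M)"

definition hadamard :: "complex^'n^'m \<Rightarrow> complex^'n^'m \<Rightarrow> complex^'n^'m" where
  "hadamard M N = (\<chi> p q. M $ p $ q * N $ p $ q)"

text \<open>The values of \<open>core_map\<close> are complex matrices; its codomain, the real skew-symmetric matrices,
  appears as the image of \<open>Skew\<close> under the embedding \<open>map_matrix complex_of_real\<close>.\<close>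

definition core_map ::
    "(nat \<Rightarrow> real) \<Rightarrow> real^'n::{finite,linorder}^'n::{finite,linorder} \<Rightarrow> complex^'n::{finite,linorder}^'n::{finite,linorder}" where
  "core_map \<Theta> M =
     Umat ** hadamard (hermitian_transpose Umat ** map_matrix complex_of_real M ** Umat) (Phi \<Theta>)
       ** hermitian_transpose Umat"


definition angle_condition :: "nat \<Rightarrow> (nat \<Rightarrow> real) \<Rightarrow> bool" where
  "angle_condition n \<Theta> \<longleftrightarrow>
     (\<forall>i\<in>{1..n div 2}. \<forall>j\<in>{1..n div 2}. j < i \<longrightarrow> (\<forall>l::int. l \<noteq> 0 \<longrightarrow>
        \<Theta> i + \<Theta> j \<noteq> 2 * of_int l * pi \<and> \<Theta> i - \<Theta> j \<noteq> 2 * of_int l * pi)) \<and>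
     (odd n \<longrightarrow> (\<forall>j\<in>{1..n div 2}. \<forall>l::int. l \<noteq> 0 \<longrightarrow> \<Theta> j \<noteq> 2 * of_int l * pi))"

end

theory Submission
  imports Defs
begin

text \<open>Write \<open>L X = XA - AX\<close> and \<open>J X = (\<Sum>k. L\<^sup>k X / (k+1)!)\<close>. The derivative of the exponential is
  \<open>X \<mapsto> exp(A) J X\<close>, and for \<open>A\<close> in Schur form the core map is \<open>J\<close> itself: in the eigenvector
  coordinates \<open>Y = U\<^sup>H X U\<close> the map \<open>L\<close> multiplies \<open>Y\<^sub>p\<^sub>q\<close> by \<open>\<lambda>\<^sub>q - \<lambda>\<^sub>p\<close>, hence \<open>J\<close> multiplies it by \<open>\<phi>\<^sub>p\<^sub>q\<close>.
  As \<open>J\<close> commutes with orthogonal conjugation, both maps are invertible exactly when \<open>J\<close> is bijective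
  on the skew matrices for the Schur form. If \<open>\<phi>\<^sub>p\<^sub>q = 0\<close> with \<open>p, q\<close> in different \<open>2 \<times> 2\<close> blocks, then
  every matrix in the image has \<open>Y\<^sub>p\<^sub>q = 0\<close>, so \<open>J\<close> is not onto; conversely \<open>J\<close> has no kernel if these
  \<open>\<phi>\<^sub>p\<^sub>q\<close> are nonzero, because the off-diagonal coordinates inside a block vanish for skew \<open>X\<close>.\<close>

section \<open>The derivative of the matrix exponential\<close>

lemma bounded_bilinear_matrix_matrix_mult:
  "bounded_bilinear ((**) :: real^'n^'n \<Rightarrow> real^'n^'n \<Rightarrow> real^'n^'n)"
proof -
  have "bilinear ((**) :: real^'n^'n \<Rightarrow> real^'n^'n \<Rightarrow> real^'n^'n)"
    unfolding bilinear_def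
    by (auto intro!: linearI simp: matrix_matrix_mult_def vec_eq_iff algebra_simps
        sum.distrib sum_distrib_left)
  then show ?thesis by (simp add: bilinear_conv_bounded_bilinear)
qed

interpretation matrix_mult:
  bounded_bilinear "(**) :: real^'n^'n \<Rightarrow> real^'n^'n \<Rightarrow> real^'n^'n"
  by (rule bounded_bilinear_matrix_matrix_mult)

definition commutator_map :: "real^'n^'n \<Rightarrow> real^'n^'n \<Rightarrow> real^'n^'n" where
  "commutator_map A X = X ** A - A ** X"

text \<open>This is the entire function (e^z - 1)/z evaluated at the operator
  \<open>commutator_map A\<close>, that is (1 - e^(-ad A))/(ad A). The sign convention of the
  commutator is the one that puts \<open>mexp A\<close> on the left of the derivative, as in
  \<open>tangent_SO\<close>.\<close>

definition dexp_factor :: "real^'n^'n \<Rightarrow> real^'n^'n \<Rightarrow> real^'n^'n" where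
  "dexp_factor A X = (\<Sum>k. (1 / fact (Suc k)) *\<^sub>R (commutator_map A ^^ k) X)"

text \<open>The derivative of the n-th matrix power at \<open>A\<close> in direction
  \<open>X\<close>; the recursion is the product rule for \<open>A ** mpow A k\<close>.\<close>

primrec dmpow :: "real^'n^'n \<Rightarrow> nat \<Rightarrow> real^'n^'n \<Rightarrow> real^'n^'n" where
  "dmpow A 0 X = 0"
| "dmpow A (Suc k) X = A ** dmpow A k X + X ** mpow A k"

lemma mpow_add: "mpow A (i + j) = mpow A i ** mpow A j"
  by (induction i) (simp_all add: matrix_mul_assoc)

lemma mpow_uminus: "mpow (- A) k = (- 1) ^ k *\<^sub>R mpow A k"
  by (induction k) (simp_all add: matrix_mult.minus_left matrix_mult.scaleR_right)

lemma linear_commutator_map: "linear (commutator_map A)"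
  by (intro linearI) (simp_all add: commutator_map_def matrix_mult.add_left matrix_mult.add_right
      matrix_mult.scaleR_left matrix_mult.scaleR_right algebra_simps)

lemma linear_commutator_map_funpow: "linear (commutator_map A ^^ k)"
proof (induction k)
  case (Suc k)
  then show ?case using linear_compose[OF Suc linear_commutator_map] by (simp add: o_def)
qed (simp add: linear_iff)

section \<open>Growth bounds and absolute convergence of the matrix series\<close>

lemma matrix_mult_norm_bound:
  obtains K where "K \<ge> 1" "\<And>(A :: real^'n^'n) (B :: real^'n^'n). norm (A ** B) \<le> K * norm A * norm B"
proof -
  obtain K where K: "K > 0" "\<And>(A :: real^'n^'n) (B :: real^'n^'n). norm (A ** B) \<le> norm A * norm B * K"
    using matrix_mult.pos_bounded by blast
  have "norm (A ** B) \<le> max 1 K * norm A * norm B" for A B :: "real^'n^'n"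
  proof -
    have "norm A * norm B * K \<le> norm A * norm B * max 1 K"
      by (intro mult_left_mono) auto
    then show ?thesis using K(2)[of A B] by (simp add: mult_ac)
  qed
  then show ?thesis using that[of "max 1 K"] by auto
qed

lemma norm_mpow_le:
  fixes A :: "real^'n^'n"
  assumes K: "K \<ge> 0" "\<And>(A :: real^'n^'n) (B :: real^'n^'n). norm (A ** B) \<le> K * norm A * norm B"
    and A: "norm A \<le> r"
  shows "norm (mpow A n) \<le> norm (mat 1 :: real^'n^'n) * (K * r) ^ n"
proof (induction n)
  case (Suc n)
  have "0 \<le> r" using A norm_ge_zero order_trans by blast
  have "norm (mpow A (Suc n)) \<le> K * norm A * norm (mpow A n)"
    using K(2) by simp
  also have "\<dots> \<le> K * r * (norm (mat 1 :: real^'n^'n) * (K * r) ^ n)"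
    using A K(1) Suc.IH \<open>0 \<le> r\<close> by (intro mult_mono) auto
  finally show ?case by (simp add: mult_ac)
qed simp

text \<open>A bound uniform over a ball of radius \<open>r\<close>, which later majorises the
  differentiated series. It mirrors n r^(n-1); for \<open>n = 0\<close> the truncated exponent is
  harmless because of the factor \<open>real n\<close>.\<close>

lemma norm_dmpow_le:
  fixes A X :: "real^'n^'n"
  assumes K: "K \<ge> 0" "\<And>(A :: real^'n^'n) (B :: real^'n^'n). norm (A ** B) \<le> K * norm A * norm B"
    and A: "norm A \<le> r"
  shows "norm (dmpow A n X) \<le>
    real n * (K * norm (mat 1 :: real^'n^'n) * (K * r) ^ (n - 1)) * norm X"
proof (induction n)
  case (Suc n)
  let ?c = "norm (mat 1 :: real^'n^'n)"
  have "0 \<le> r" using A norm_ge_zero order_trans by blast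
  have "norm (A ** dmpow A n X) \<le> K * norm A * norm (dmpow A n X)" by (rule K(2))
  also have "\<dots> \<le> K * r * (real n * (K * ?c * (K * r) ^ (n - 1)) * norm X)"
    using A K(1) Suc.IH \<open>0 \<le> r\<close> by (intro mult_mono) auto
  also have "\<dots> = real n * (K * ?c * (K * r) ^ n) * norm X"
    by (cases n) (simp_all add: mult_ac)
  finally have 1: "norm (A ** dmpow A n X) \<le> real n * (K * ?c * (K * r) ^ n) * norm X" .
  have "norm (X ** mpow A n) \<le> K * norm X * norm (mpow A n)" by (rule K(2))
  also have "\<dots> \<le> K * norm X * (?c * (K * r) ^ n)"
    using norm_mpow_le[OF K A] K(1) by (intro mult_left_mono) auto
  finally have 2: "norm (X ** mpow A n) \<le> (K * ?c * (K * r) ^ n) * norm X" by (simp add: mult_ac)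
  have "norm (dmpow A (Suc n) X) \<le> norm (A ** dmpow A n X) + norm (X ** mpow A n)"
    by (simp add: norm_triangle_ineq)
  with 1 2 show ?case by (simp add: distrib_right)
qed simp

lemma summable_const_power_div_fact: "summable (\<lambda>n. c * x ^ n / fact n)" for c x :: real
  using summable_mult[OF summable_exp[of x], of c] by (simp add: field_simps)

lemma summable_norm_mpow: "summable (\<lambda>k. norm ((1 / fact k) *\<^sub>R mpow A k))"
  for A :: "real^'n^'n"
proof -
  obtain K where K: "K \<ge> 1" "\<And>(A :: real^'n^'n) (B :: real^'n^'n). norm (A ** B) \<le> K * norm A * norm B"
    by (rule matrix_mult_norm_bound) blast
  let ?c = "norm (mat 1 :: real^'n^'n)"
  show ?thesis
  proof (rule summable_comparison_test')
    show "summable (\<lambda>k. ?c * (K * norm A) ^ k / fact k)"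
      by (rule summable_const_power_div_fact)
    show "norm (norm ((1 / fact k) *\<^sub>R mpow A k)) \<le> ?c * (K * norm A) ^ k / fact k" for k
      using norm_mpow_le[OF _ K(2) order_refl, of A k] K(1) by (simp add: divide_right_mono)
  qed
qed

lemma mexp_sums: "(\<lambda>k. (1 / fact k) *\<^sub>R mpow A k) sums mexp A"
  unfolding mexp_def by (rule summable_sums[OF summable_norm_cancel[OF summable_norm_mpow]])

text \<open>The operator \<open>commutator_map A\<close> is bounded, so its powers grow at most
  geometrically and the factorials dominate.\<close>

lemma summable_norm_dexp_factor:
  "summable (\<lambda>k. norm ((1 / fact (Suc k)) *\<^sub>R (commutator_map A ^^ k) X))"
  for A :: "real^'n^'n"
proof -
  have "bounded_linear (commutator_map A)"
    using linear_commutator_map linear_conv_bounded_linear by blast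
  then obtain C where C: "C > 0" "\<And>X. norm (commutator_map A X) \<le> norm X * C"
    using bounded_linear.pos_bounded by blast
  have pow: "norm ((commutator_map A ^^ k) X) \<le> norm X * C ^ k" for k
  proof (induction k)
    case (Suc k)
    have "norm (commutator_map A ((commutator_map A ^^ k) X)) \<le> norm ((commutator_map A ^^ k) X) * C"
      by (rule C(2))
    also have "\<dots> \<le> norm X * C ^ k * C" using Suc.IH C(1) by (intro mult_right_mono) auto
    finally show ?case by (simp add: mult_ac)
  qed simp
  show ?thesis
  proof (rule summable_comparison_test')
    show "summable (\<lambda>k. norm X * C ^ k / fact k)"
      by (rule summable_const_power_div_fact)
    fix k
    have "norm ((commutator_map A ^^ k) X) / fact (Suc k) \<le> norm X * C ^ k / fact k"
      using pow[of k] C(1) by (intro frac_le) (auto intro: fact_mono)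
    then show "norm (norm ((1 / fact (Suc k)) *\<^sub>R (commutator_map A ^^ k) X)) \<le> norm X * C ^ k / fact k"
      by simp
  qed
qed

lemma dexp_factor_sums:
  "(\<lambda>k. (1 / fact (Suc k)) *\<^sub>R (commutator_map A ^^ k) X) sums dexp_factor A X"
  unfolding dexp_factor_def
  by (rule summable_sums[OF summable_norm_cancel[OF summable_norm_dexp_factor]])

lemma linear_dexp_factor: "linear (dexp_factor A)"
proof (rule linearI)
  note lin = linear_commutator_map_funpow[of _ A]
  show "dexp_factor A (X + Y) = dexp_factor A X + dexp_factor A Y" for X Y
    using sums_add[OF dexp_factor_sums[of A X] dexp_factor_sums[of A Y]]
    unfolding scaleR_add_right[symmetric] linear_add[OF lin, symmetric]
    by (rule sums_unique2[OF dexp_factor_sums])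
  show "dexp_factor A (c *\<^sub>R X) = c *\<^sub>R dexp_factor A X" for c X
  proof (rule sums_unique2[OF dexp_factor_sums])
    show "(\<lambda>k. (1 / fact (Suc k)) *\<^sub>R (commutator_map A ^^ k) (c *\<^sub>R X)) sums (c *\<^sub>R dexp_factor A X)"
      using bounded_linear.sums[OF bounded_linear_scaleR_right dexp_factor_sums[of A X], of c]
      by (simp add: linear_scale[OF lin] mult.commute del: fact_Suc)
  qed
qed

section \<open>Cauchy products of matrix series and the inverse of the exponential\<close>

lemma matrix_Cauchy_product_sums:
  fixes f g :: "nat \<Rightarrow> real^'n^'n"
  assumes f: "summable (\<lambda>k. norm (f k))" and g: "summable (\<lambda>k. norm (g k))"
  shows "(\<lambda>k. \<Sum>i\<le>k. f i ** g (k - i)) sums ((\<Sum>k. f k) ** (\<Sum>k. g k))"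
proof -
  have entry: "summable (\<lambda>k. norm (h k $ p $ q)) \<and> (\<Sum>k. h k) $ p $ q = (\<Sum>k. h k $ p $ q)"
    if h: "summable (\<lambda>k. norm (h k))" for h :: "nat \<Rightarrow> real^'n^'n" and p q
  proof
    show "summable (\<lambda>k. norm (h k $ p $ q))"
    proof (rule summable_comparison_test'[OF h])
      show "norm (norm (h k $ p $ q)) \<le> norm (h k)" for k
        using Finite_Cartesian_Product.norm_nth_le[of "h k $ p" q]
          Finite_Cartesian_Product.norm_nth_le[of "h k" p] by simp
    qed
    have "(\<lambda>k. h k $ p $ q) sums ((\<Sum>k. h k) $ p $ q)"
      using bounded_linear.sums[OF bounded_linear_compose[OF bounded_linear_vec_nth[of q]
            bounded_linear_vec_nth[of p]] summable_sums[OF summable_norm_cancel[OF h]]] .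
    then show "(\<Sum>k. h k) $ p $ q = (\<Sum>k. h k $ p $ q)" by (rule sums_unique)
  qed
  have "(\<lambda>k. (\<Sum>i\<le>k. f i ** g (k - i)) $ p $ q) sums (((\<Sum>k. f k) ** (\<Sum>k. g k)) $ p $ q)" for p q
  proof -
    \<comment> \<open>For each middle index \<open>l\<close> of the matrix product the scalar Cauchy
      product theorem applies; the finite sum over \<open>l\<close> then reassembles the matrix
      entry.\<close>
    have "(\<lambda>k. \<Sum>l\<in>UNIV. \<Sum>i\<le>k. f i $ p $ l * g (k - i) $ l $ q) sums
        (\<Sum>l\<in>UNIV. (\<Sum>k. f k $ p $ l) * (\<Sum>k. g k $ l $ q))"
      using entry[OF f] entry[OF g] by (intro sums_sum Cauchy_product_sums) auto
    also have "(\<lambda>k. \<Sum>l\<in>UNIV. \<Sum>i\<le>k. f i $ p $ l * g (k - i) $ l $ q)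
        = (\<lambda>k. (\<Sum>i\<le>k. f i ** g (k - i)) $ p $ q)"
      by (subst sum.swap) (simp add: matrix_matrix_mult_def)
    finally show ?thesis using entry[OF f] entry[OF g] by (simp add: matrix_matrix_mult_def)
  qed
  then show ?thesis
    unfolding sums_def by (intro vec_tendstoI) (simp flip: sum_component)
qed

text \<open>In the Cauchy product the coefficient of \<open>mpow A k\<close> is (1 - 1)^k / k!, so
  only the term \<open>k = 0\<close> survives. Invertibility of \<open>mexp A\<close> is what later
  allows it to be cancelled from the derivative.\<close>

lemma mexp_inverse: "mexp A ** mexp (- A) = mat 1"
proof -
  have "(\<lambda>k. \<Sum>i\<le>k. ((1 / fact i) *\<^sub>R mpow A i) ** ((1 / fact (k - i)) *\<^sub>R mpow (- A) (k - i)))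
      sums (mexp A ** mexp (- A))"
    unfolding mexp_def by (intro matrix_Cauchy_product_sums summable_norm_mpow)
  also have "(\<lambda>k. \<Sum>i\<le>k. ((1 / fact i) *\<^sub>R mpow A i) ** ((1 / fact (k - i)) *\<^sub>R mpow (- A) (k - i)))
      = (\<lambda>k. if k = 0 then mat 1 else 0)"
  proof
    fix k
    have "(\<Sum>i\<le>k. ((1 / fact i) *\<^sub>R mpow A i) ** ((1 / fact (k - i)) *\<^sub>R mpow (- A) (k - i)))
        = (\<Sum>i\<le>k. ((-1) ^ (k - i) / (fact i * fact (k - i))) *\<^sub>R mpow A k)"
      by (intro sum.cong) (simp_all add: mpow_uminus matrix_mult.scaleR_left
          matrix_mult.scaleR_right flip: mpow_add)
    also have "\<dots> = (1 / fact k * (\<Sum>i\<le>k. (-1) ^ (k - i) * of_nat (k choose i))) *\<^sub>R mpow A k"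
      by (simp add: scaleR_sum_left sum_distrib_left binomial_fact mult_ac)
    also have "(\<Sum>i\<le>k. (-1) ^ (k - i) * of_nat (k choose i)) = (0::real) ^ k"
      using binomial_ring[of "1::real" "-1" k] by (simp add: mult_ac)
    finally show "(\<Sum>i\<le>k. ((1 / fact i) *\<^sub>R mpow A i) ** ((1 / fact (k - i)) *\<^sub>R mpow (- A) (k - i)))
        = (if k = 0 then mat 1 else 0)" by simp
  qed
  finally show ?thesis
    by (rule sums_unique2[OF _ sums_single])
qed

section \<open>Termwise differentiation of the exponential series\<close>

lemma mpow_has_derivative:
  "((\<lambda>A. mpow A n) has_derivative dmpow A n) (at A within S)"
proof (induction n)
  case 0
  have "dmpow A 0 = (\<lambda>X. 0)" by (simp add: fun_eq_iff)
  then show ?case by simp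
next
  case (Suc n)
  show ?case
    using matrix_mult.FDERIV[OF has_derivative_ident Suc.IH] by simp
qed

text \<open>The commutator makes the sum \<open>A\<^sup>n\<^sup>-\<^sup>1X + \<dots> + XA\<^sup>n\<^sup>-\<^sup>1\<close> telescope.\<close>

lemma dmpow_commutator_map: "dmpow A n (commutator_map A X) = X ** mpow A n - mpow A n ** X"
proof (induction n)
  case (Suc n)
  then show ?case
    by (simp add: commutator_map_def matrix_mult.diff_right matrix_mult.diff_left matrix_mul_assoc)
qed simp

text \<open>The right side is a coefficient of the Cauchy product of the series for
  \<open>mexp A\<close> and \<open>dexp_factor A X\<close>, so summing over \<open>n\<close> gives
  the derivative formula. The induction applies the hypothesis both to \<open>X\<close> and to
  \<open>commutator_map A X\<close>.\<close>

lemma dmpow_eq_sum: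
  "(1 / fact (Suc n)) *\<^sub>R dmpow A (Suc n) X =
    (\<Sum>i\<le>n. ((1 / fact i) *\<^sub>R mpow A i) **
       ((1 / fact (Suc (n - i))) *\<^sub>R (commutator_map A ^^ (n - i)) X))"
proof (induction n arbitrary: X)
  case (Suc n)
  define a where "a i = (1 / fact i) *\<^sub>R mpow A i" for i
  define b where "b k X = (1 / fact (Suc k)) *\<^sub>R (commutator_map A ^^ k) X" for k X
  have a_Suc: "real (Suc i) *\<^sub>R a (Suc i) = A ** a i" for i
    by (simp add: a_def matrix_mult.scaleR_right del: of_nat_Suc)
  have b_Suc: "real (k + 2) *\<^sub>R b (Suc k) X = b k (commutator_map A X)" for k X
  proof -
    have "real (k + 2) * (1 / fact (Suc (Suc k))) = 1 / fact (Suc k)"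
      using fact_Suc[of "Suc k", where 'a = real] by (simp del: fact_Suc of_nat_Suc)
    then show ?thesis unfolding b_def by (simp only: scaleR_scaleR funpow_Suc_right o_apply)
  qed
  have IH: "(1 / fact (Suc n)) *\<^sub>R dmpow A (Suc n) X = (\<Sum>i\<le>n. a i ** b (n - i) X)" for X
    using Suc.IH unfolding a_def b_def .
  \<comment> \<open>The weight n + 2 is split as i + (n + 2 - i): the first part lowers the
    factorial of the power of \<open>A\<close>, the second that of the power of the
    commutator.\<close>
  have "real (n + 2) *\<^sub>R (\<Sum>i\<le>Suc n. a i ** b (Suc n - i) X)
      = (\<Sum>i\<le>Suc n. (real i *\<^sub>R a i) ** b (Suc n - i) X)
        + (\<Sum>i\<le>Suc n. a i ** (real (Suc n - i + 1) *\<^sub>R b (Suc n - i) X))"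
    unfolding scaleR_sum_right sum.distrib[symmetric]
  proof (rule sum.cong)
    fix i assume "i \<in> {..Suc n}"
    then have "real (n + 2) = real i + real (Suc n - i + 1)" by simp
    then show "real (n + 2) *\<^sub>R (a i ** b (Suc n - i) X) = (real i *\<^sub>R a i) ** b (Suc n - i) X
        + a i ** (real (Suc n - i + 1) *\<^sub>R b (Suc n - i) X)"
      by (simp only: matrix_mult.scaleR_left matrix_mult.scaleR_right scaleR_add_left)
  qed simp
  \<comment> \<open>The term \<open>i = 0\<close> has weight zero; shifting the index pulls one
    factor \<open>A\<close> out of the rest.\<close>
  also have "(\<Sum>i\<le>Suc n. (real i *\<^sub>R a i) ** b (Suc n - i) X)
      = A ** (\<Sum>i\<le>n. a i ** b (n - i) X)"
    unfolding sum.atMost_Suc_shift a_Suc matrix_mult.sum_right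
    by (simp add: matrix_mul_assoc matrix_mult.zero_left)
  \<comment> \<open>The term \<open>i = Suc n\<close> stays apart: there \<open>b 0 X = X\<close>
    contains no commutator to move into the argument.\<close>
  also have "(\<Sum>i\<le>Suc n. a i ** (real (Suc n - i + 1) *\<^sub>R b (Suc n - i) X))
      = (\<Sum>i\<le>n. a i ** b (n - i) (commutator_map A X)) + a (Suc n) ** X"
  proof -
    have "(\<Sum>i\<le>n. a i ** (real (Suc n - i + 1) *\<^sub>R b (Suc n - i) X))
        = (\<Sum>i\<le>n. a i ** b (n - i) (commutator_map A X))"
    proof (rule sum.cong)
      fix i assume "i \<in> {..n}"
      then have "Suc n - i = Suc (n - i)" by simp
      then show "a i ** (real (Suc n - i + 1) *\<^sub>R b (Suc n - i) X)
          = a i ** b (n - i) (commutator_map A X)"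
        using b_Suc[of "n - i" X] by simp
    qed simp
    then show ?thesis by (simp add: b_def)
  qed
  \<comment> \<open>By \<open>dmpow_commutator_map\<close> the middle sum is a multiple of
    \<open>X ** mpow A (Suc n) - mpow A (Suc n) ** X\<close>. Its negative part cancels
    \<open>a (Suc n) ** X\<close>, and the product rule for \<open>dmpow\<close> remains.\<close>
  also have "A ** (\<Sum>i\<le>n. a i ** b (n - i) X)
        + ((\<Sum>i\<le>n. a i ** b (n - i) (commutator_map A X)) + a (Suc n) ** X)
      = (1 / fact (Suc n)) *\<^sub>R dmpow A (Suc (Suc n)) X"
    unfolding IH[symmetric] unfolding dmpow_commutator_map a_def dmpow.simps(2)[of A "Suc n"]
    by (simp only: matrix_mult.scaleR_right matrix_mult.scaleR_left flip: scaleR_add_right) simp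
  finally have "(\<Sum>i\<le>Suc n. a i ** b (Suc n - i) X)
      = (1 / real (n + 2)) *\<^sub>R (1 / fact (Suc n)) *\<^sub>R dmpow A (Suc (Suc n)) X"
    by (simp del: fact_Suc dmpow.simps flip: scaleR_scaleR add: eq_vector_fraction_iff)
  then show ?case unfolding a_def b_def
    by (simp add: field_simps del: dmpow.simps)
qed (simp add: matrix_mult.add_left)

lemma dmpow_sums:
  "(\<lambda>n. (1 / fact n) *\<^sub>R dmpow A n X) sums (mexp A ** dexp_factor A X)"
proof -
  have "(\<lambda>n. (1 / fact (Suc n)) *\<^sub>R dmpow A (Suc n) X) sums (mexp A ** dexp_factor A X)"
    unfolding dmpow_eq_sum mexp_def dexp_factor_def
    by (intro matrix_Cauchy_product_sums summable_norm_mpow summable_norm_dexp_factor)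
  \<comment> \<open>The term of index 0 is the derivative of a constant, so shifting the series does
    not change its sum.\<close>
  then show ?thesis by (subst (asm) sums_Suc_iff) simp
qed

text \<open>The differentiated series converges uniformly on a ball around 0 containing
  \<open>A\<close>, relative to the norm of the direction \<open>X\<close>; hence the series may be
  differentiated term by term.\<close>

lemma mexp_has_derivative:
  fixes A :: "real^'n^'n"
  shows "(mexp has_derivative (\<lambda>X. mexp A ** dexp_factor A X)) (at A within S)"
proof -
  obtain K where K: "K \<ge> 1" "\<And>(A :: real^'n^'n) (B :: real^'n^'n). norm (A ** B) \<le> K * norm A * norm B"
    by (rule matrix_mult_norm_bound) blast
  define r where "r = norm A + 1"
  \<comment> \<open>\<open>M\<close> is a Weierstrass majorant: \<open>M n * norm X\<close> bounds
    the n-th differentiated term at every point of the ball.\<close>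
  define M where "M n = real n * (K * norm (mat 1 :: real^'n^'n) * (K * r) ^ (n - 1)) / fact n" for n
  have r: "r > 0" by (simp add: r_def add_nonneg_pos)
  have "M (Suc n) = K * norm (mat 1 :: real^'n^'n) * (K * r) ^ n / fact n" for n
    by (simp add: M_def del: of_nat_Suc)
  then have "summable (\<lambda>n. M (Suc n))"
    using summable_const_power_div_fact by simp
  then have M: "summable M" by (simp add: summable_Suc_iff)
  have term_bound: "norm ((1 / fact n) *\<^sub>R dmpow B n X) \<le> M n * norm X" if "B \<in> ball 0 r" for B X :: "real^'n^'n" and n
    using norm_dmpow_le[OF _ K(2), of B r n X] K(1) that
    by (simp add: M_def divide_right_mono)
  have "\<exists>g. \<forall>B\<in>ball (0 :: real^'n^'n) r. (\<lambda>n. (1 / fact n) *\<^sub>R mpow B n) sums g B \<and>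
      (g has_derivative (\<lambda>X. mexp B ** dexp_factor B X)) (at B within ball 0 r)"
  proof (rule has_derivative_series)
    show "((\<lambda>B. (1 / fact n) *\<^sub>R mpow B n) has_derivative (\<lambda>X. (1 / fact n) *\<^sub>R dmpow B n X))
        (at B within ball 0 r)" for n and B :: "real^'n^'n"
      by (intro has_derivative_scaleR_right mpow_has_derivative)
    \<comment> \<open>The error of a partial sum is a tail of the series, bounded by the tail of
      \<open>M\<close> independently of \<open>B\<close>.\<close>
    show "\<forall>\<^sub>F n in sequentially. \<forall>B\<in>ball (0 :: real^'n^'n) r. \<forall>X.
        norm ((\<Sum>i<n. (1 / fact i) *\<^sub>R dmpow B i X) - mexp B ** dexp_factor B X) \<le> e * norm X"
      if "e > 0" for e :: real
    proof -
      obtain N where N: "\<And>n. n \<ge> N \<Longrightarrow> norm (\<Sum>i. M (i + n)) < e"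
        using suminf_exist_split[OF \<open>e > 0\<close> M] by blast
      have "norm ((\<Sum>i<n. (1 / fact i) *\<^sub>R dmpow B i X) - mexp B ** dexp_factor B X) \<le> e * norm X"
        if n: "n \<ge> N" and B: "B \<in> ball 0 r" for n and B X :: "real^'n^'n"
      proof -
        let ?f = "\<lambda>i. (1 / fact i) *\<^sub>R dmpow B i X"
        have tail: "(\<lambda>i. ?f (i + n)) sums (mexp B ** dexp_factor B X - (\<Sum>i<n. ?f i))"
          using sums_split_initial_segment[OF dmpow_sums] .
        have Mn: "summable (\<lambda>i. M (i + n) * norm X)"
          using M by (intro summable_mult2) (simp add: summable_iff_shift)
        have "norm (mexp B ** dexp_factor B X - (\<Sum>i<n. ?f i)) = norm (\<Sum>i. ?f (i + n))"
          using tail by (simp add: sums_iff)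
        also have "\<dots> \<le> (\<Sum>i. M (i + n) * norm X)"
          using term_bound[OF B] Mn by (intro norm_suminf_le) auto
        also have "\<dots> = (\<Sum>i. M (i + n)) * norm X"
          using M by (intro suminf_mult2[symmetric]) (simp add: summable_iff_shift)
        also have "\<dots> \<le> e * norm X" using N[OF n] by (intro mult_right_mono) auto
        finally show ?thesis by (simp add: norm_minus_commute)
      qed
      then show ?thesis unfolding eventually_sequentially by blast
    qed
    show "A \<in> ball 0 r" by (simp add: r_def)
  qed (auto intro: mexp_sums)
  then obtain g :: "real^'n^'n \<Rightarrow> real^'n^'n"
    where g: "\<And>B. B \<in> ball 0 r \<Longrightarrow> (\<lambda>n. (1 / fact n) *\<^sub>R mpow B n) sums g B"
    "\<And>B. B \<in> ball 0 r \<Longrightarrow> (g has_derivative (\<lambda>X. mexp B ** dexp_factor B X)) (at B within ball 0 r)"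
    by blast
  have A: "A \<in> ball 0 r" by (simp add: r_def)
  \<comment> \<open>The limit function \<open>g\<close> agrees with \<open>mexp\<close> on the ball
    by uniqueness of sums. Since the ball is open, its derivative there is the full derivative,
    which restricts to any \<open>S\<close>.\<close>
  have "(mexp has_derivative (\<lambda>X. mexp A ** dexp_factor A X)) (at A within ball 0 r)"
    using g(2)[OF A] A by (rule has_derivative_transform[rotated 2])
      (use g(1) mexp_sums sums_unique2 in blast)
  then show ?thesis
    using A at_within_open[of A "ball 0 r"] has_derivative_at_withinI by force
qed

section \<open>Restriction to skew-symmetric matrices\<close>

lemma Skew_iff: "A \<in> Skew \<longleftrightarrow> transpose A = - A"
  unfolding Skew_def by (auto simp: add_eq_0_iff)

lemma linear_transpose: "linear (transpose :: real^'n^'m \<Rightarrow> real^'m^'n)"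
  by (intro linearI) (simp_all add: transpose_def vec_eq_iff)

lemma subspace_Skew: "subspace (Skew :: (real^'n^'n) set)"
proof -
  interpret linear "transpose :: real^'n^'n \<Rightarrow> real^'n^'n" by (rule linear_transpose)
  show ?thesis by (auto simp: subspace_def Skew_iff zero add scale)
qed

lemma commutator_map_Skew: "A \<in> Skew \<Longrightarrow> X \<in> Skew \<Longrightarrow> commutator_map A X \<in> Skew"
proof -
  interpret linear "transpose :: real^'n^'n \<Rightarrow> real^'n^'n" by (rule linear_transpose)
  assume "A \<in> Skew" "X \<in> Skew"
  then show ?thesis
    by (simp add: Skew_iff commutator_map_def diff matrix_transpose_mul
        matrix_mult.minus_left matrix_mult.minus_right)
qed

lemma dexp_factor_Skew:
  assumes A: "A \<in> Skew" and X: "X \<in> Skew"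
  shows "dexp_factor A X \<in> Skew"
proof -
  have pow: "(commutator_map A ^^ k) X \<in> Skew" for k
    using commutator_map_Skew[OF A] X by (induction k) auto
  have "(\<Sum>k<n. (1 / fact (Suc k)) *\<^sub>R (commutator_map A ^^ k) X) \<in> Skew" for n
    using subspace_Skew pow by (intro subspace_sum subspace_scale) auto
  \<comment> \<open>The partial sums lie in a subspace, and a subspace of a finite-dimensional space
    is closed.\<close>
  then show ?thesis
    using dexp_factor_sums closed_subspace[OF subspace_Skew]
    unfolding sums_def by (rule_tac closed_sequentially) auto
qed

text \<open>A trivial kernel makes the image equal in dimension to \<open>S\<close>; being contained
  in \<open>S\<close>, it is all of \<open>S\<close>.\<close>

lemma linear_bij_betw_subspace:
  fixes f :: "'a::euclidean_space \<Rightarrow> 'a"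
  assumes "linear f" "subspace S" "f ` S \<subseteq> S" "\<And>x. x \<in> S \<Longrightarrow> f x = 0 \<Longrightarrow> x = 0"
  shows "bij_betw f S S"
proof -
  have inj: "inj_on f S"
    using assms(1,2,4) by (simp add: linear_injective_on_subspace_0)
  have "dim (f ` S) = dim S"
    using assms(1,2) inj by (intro dim_image_eq) (simp_all add: span_eq_iff[THEN iffD2])
  then have "f ` S = S"
    using assms by (intro subspace_dim_equal) (auto intro: linear_subspace_image)
  with inj show ?thesis by (simp add: bij_betw_def)
qed

section \<open>Orthogonal conjugation and removal of the factor \<open>mexp A\<close>\<close>

lemma orthogonal_conjugate_Skew:
  fixes R X :: "real^'n^'n"
  shows "X \<in> Skew \<Longrightarrow> R ** X ** transpose R \<in> Skew"
  by (simp add: Skew_iff matrix_transpose_mul matrix_mult.minus_left matrix_mult.minus_right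
      matrix_mul_assoc)

text \<open>Conjugation by \<open>R\<close> is multiplicative, so it commutes with commutators and
  their powers, and by continuity with the series.\<close>

lemma dexp_factor_orthogonal_conjugate:
  fixes R :: "real^'n^'n"
  assumes R: "orthogonal_matrix R"
  shows "dexp_factor (R ** A ** transpose R) (R ** X ** transpose R) = R ** dexp_factor A X ** transpose R"
proof -
  have RR: "transpose R ** R = mat 1" using R by (simp add: orthogonal_matrix_def)
  have cancel: "R ** B ** transpose R ** (R ** C ** transpose R) = R ** (B ** C) ** transpose R" for B C
  proof -
    have "R ** B ** transpose R ** (R ** C ** transpose R)
        = R ** B ** (transpose R ** R) ** C ** transpose R" by (simp add: matrix_mul_assoc)
    then show ?thesis by (simp add: RR matrix_mul_assoc)
  qed
  have comm: "commutator_map (R ** A ** transpose R) (R ** Y ** transpose R)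
      = R ** commutator_map A Y ** transpose R" for Y
    by (simp add: commutator_map_def cancel matrix_mult.diff_left matrix_mult.diff_right)
  have pow: "(commutator_map (R ** A ** transpose R) ^^ k) (R ** X ** transpose R)
      = R ** (commutator_map A ^^ k) X ** transpose R" for k
    by (induction k) (simp_all add: comm)
  have "(\<lambda>k. R ** ((1 / fact (Suc k)) *\<^sub>R (commutator_map A ^^ k) X) ** transpose R)
      sums (R ** dexp_factor A X ** transpose R)"
    by (intro bounded_linear.sums[OF matrix_mult.bounded_linear_left]
        bounded_linear.sums[OF matrix_mult.bounded_linear_right] dexp_factor_sums)
  then show ?thesis
    by (intro sums_unique2[OF dexp_factor_sums])
       (simp add: pow matrix_mult.scaleR_left matrix_mult.scaleR_right)
qed

lemma bij_betw_orthogonal_conjugate: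
  fixes R :: "real^'n^'n"
  assumes R: "orthogonal_matrix R"
  shows "bij_betw (\<lambda>X. R ** X ** transpose R) Skew Skew"
proof (rule bij_betw_byWitness[where f' = "\<lambda>X. transpose R ** X ** R"])
  have RR: "transpose R ** R = mat 1" "R ** transpose R = mat 1"
    using R by (auto simp: orthogonal_matrix_def)
  have "transpose R ** (R ** X ** transpose R) ** R
      = (transpose R ** R) ** X ** (transpose R ** R)" for X
    by (simp add: matrix_mul_assoc)
  then show "\<forall>X\<in>Skew. transpose R ** (R ** X ** transpose R) ** R = X" by (simp add: RR)
  have "R ** (transpose R ** X ** R) ** transpose R
      = (R ** transpose R) ** X ** (R ** transpose R)" for X
    by (simp add: matrix_mul_assoc)
  then show "\<forall>X\<in>Skew. R ** (transpose R ** X ** R) ** transpose R = X" by (simp add: RR)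
  show "(\<lambda>X. R ** X ** transpose R) ` Skew \<subseteq> Skew" using orthogonal_conjugate_Skew by blast
  show "(\<lambda>X. transpose R ** X ** R) ` Skew \<subseteq> Skew"
    using orthogonal_conjugate_Skew[of _ "transpose R"] by auto
qed

lemma bij_betw_dexp_factor_conjugate:
  fixes R :: "real^'n^'n"
  assumes R: "orthogonal_matrix R" and A: "A \<in> Skew"
  shows "bij_betw (dexp_factor (R ** A ** transpose R)) Skew Skew \<longleftrightarrow> bij_betw (dexp_factor A) Skew Skew"
    (is "bij_betw ?f Skew Skew \<longleftrightarrow> bij_betw ?g Skew Skew")
proof -
  let ?c = "\<lambda>X. R ** X ** transpose R"
  have c: "bij_betw ?c Skew Skew" by (rule bij_betw_orthogonal_conjugate[OF R])
  have "bij_betw ?f Skew Skew \<longleftrightarrow> bij_betw (?f \<circ> ?c) Skew Skew"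
    using c by (rule bij_betw_comp_iff)
  also have "?f \<circ> ?c = ?c \<circ> ?g"
    by (simp add: fun_eq_iff dexp_factor_orthogonal_conjugate[OF R])
  also have "bij_betw (?c \<circ> ?g) Skew Skew \<longleftrightarrow> bij_betw ?g Skew Skew"
    using c dexp_factor_Skew[OF A] by (intro bij_betw_comp_iff2[symmetric]) auto
  finally show ?thesis .
qed

text \<open>Left multiplication by the invertible matrix \<open>mexp A\<close> carries
  \<open>Skew\<close> bijectively onto the tangent space, so only the second factor of the
  derivative matters.\<close>

lemma bij_betw_Dexp_iff:
  fixes A :: "real^'n^'n"
  assumes A: "A \<in> Skew"
  shows "bij_betw (Dexp A) Skew (tangent_SO (mexp A)) \<longleftrightarrow> bij_betw (dexp_factor A) Skew Skew"
proof -
  let ?m = "(**) (mexp A)"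
  have tan: "tangent_SO (mexp A) = ?m ` Skew" by (auto simp: tangent_SO_def)
  have inj: "inj ?m"
  proof (rule injI)
    fix X Y assume "mexp A ** X = mexp A ** Y"
    then have "mexp (- A) ** mexp A ** X = mexp (- A) ** mexp A ** Y"
      by (simp flip: matrix_mul_assoc)
    then show "X = Y" using mexp_inverse[of "- A"] by simp
  qed
  have "bij_betw (Dexp A) Skew (tangent_SO (mexp A))
      \<longleftrightarrow> bij_betw (?m \<circ> dexp_factor A) Skew (?m ` Skew)"
    unfolding tan using Dexp_eqI[OF mexp_has_derivative A] by (intro bij_betw_cong) simp
  also have "\<dots> \<longleftrightarrow> bij_betw (dexp_factor A) Skew Skew"
    using dexp_factor_Skew[OF A] inj
    by (intro bij_betw_comp_iff2[symmetric]) (auto simp: bij_betw_def inj_def inj_on_def)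
  finally show ?thesis .
qed

section \<open>Eigenvector coordinates of the Schur form\<close>

abbreviation cmat :: "real^'n^'m \<Rightarrow> complex^'n^'m" where
  "cmat \<equiv> map_matrix complex_of_real"

text \<open>The 2 x 2 blocks are numbered from 1 to m. For odd n the last index forms block m + 1
  alone.\<close>

definition block :: "'n::{finite,linorder} \<Rightarrow> nat" where
  "block p = (pos p + 1) div 2"

definition block_pair :: "nat \<Rightarrow> 'n::{finite,linorder} \<Rightarrow> 'n \<Rightarrow> bool" where
  "block_pair \<beta> p q \<longleftrightarrow> 1 \<le> \<beta> \<and> 2 * \<beta> \<le> CARD('n) \<and> pos p = 2 * \<beta> - 1 \<and> pos q = 2 * \<beta>"

section \<open>Positions, blocks and sums over a single block\<close>

lemma pos_eq_iff: "pos p = pos q \<longleftrightarrow> p = q"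
  by (rule inj_eq[OF bij_betw_imp_inj_on[OF bij_betw_pos]])

lemma pos_bounds: "1 \<le> pos (p :: 'n::{finite,linorder})" "pos p \<le> CARD('n)"
  using bij_betwE[OF bij_betw_pos] by (metis UNIV_I atLeastAtMost_iff)+

lemma ex_pos_eq: "1 \<le> k \<Longrightarrow> k \<le> CARD('n) \<Longrightarrow> \<exists>p :: 'n::{finite,linorder}. pos p = k"
  using bij_betw_imp_surj_on[OF bij_betw_pos[where 'n = 'n]] by (metis atLeastAtMost_iff imageE)

lemma ex_block_pair:
  "\<beta> \<in> {1..CARD('n) div 2} \<Longrightarrow> \<exists>p q :: 'n::{finite,linorder}. block_pair \<beta> p q"
  using ex_pos_eq[of "2 * \<beta> - 1", where 'n = 'n] ex_pos_eq[of "2 * \<beta>", where 'n = 'n]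
  by (auto simp: block_pair_def)

lemma index_cases [case_names pair last]:
  fixes p :: "'n::{finite,linorder}"
  obtains (pair) \<beta> p1 p2 where "block_pair \<beta> p1 p2" "p = p1 \<or> p = p2"
  | (last) "odd CARD('n)" "pos p = CARD('n)"
proof (cases "2 * block p \<le> CARD('n)")
  case True
  have "1 \<le> block p" using pos_bounds(1)[of p] by (simp add: block_def)
  with True have "block p \<in> {1..CARD('n) div 2}" by auto
  then obtain p1 p2 :: 'n where pair: "block_pair (block p) p1 p2" using ex_block_pair by blast
  then have "pos p = pos p1 \<or> pos p = pos p2"
    using pos_bounds(1)[of p] unfolding block_pair_def block_def by presburger
  then show ?thesis using pair that(1) pos_eq_iff by blast
next
  case False
  then have "pos p = CARD('n) \<and> odd CARD('n)"
    using pos_bounds(2)[of p] unfolding block_def by presburger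
  then show ?thesis using that(2) by blast
qed

lemma block_pair_block:
  assumes "block_pair \<beta> p q"
  shows "block p = \<beta>" "block q = \<beta>" "p \<noteq> q" "block r = \<beta> \<longleftrightarrow> r = p \<or> r = q"
proof -
  show *: "block p = \<beta>" "block q = \<beta>" "p \<noteq> q"
    using assms by (auto simp: block_pair_def block_def)
  have "pos r = pos p \<or> pos r = pos q" if "block r = \<beta>"
    using assms that pos_bounds(1)[of r] unfolding block_pair_def block_def by presburger
  then show "block r = \<beta> \<longleftrightarrow> r = p \<or> r = q" using * by (auto simp: pos_eq_iff)
qed

lemma block_last:
  fixes p :: "'n::{finite,linorder}"
  assumes "odd CARD('n)" "pos p = CARD('n)"
  shows "block r = block p \<longleftrightarrow> r = p"
proof
  assume "block r = block p"
  then have "pos r = pos p"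
    using assms pos_bounds(2)[of r] unfolding block_def by presburger
  then show "r = p" by (simp add: pos_eq_iff)
qed simp

lemma sum_block_pair:
  fixes f :: "'n::{finite,linorder} \<Rightarrow> 'a::comm_monoid_add"
  assumes "block_pair \<beta> p q" "\<And>r. block r \<noteq> \<beta> \<Longrightarrow> f r = 0"
  shows "(\<Sum>r\<in>UNIV. f r) = f p + f q"
proof -
  have "(\<Sum>r\<in>UNIV. f r) = (\<Sum>r\<in>{p, q}. f r)"
    using assms block_pair_block(4)[OF assms(1)] by (intro sum.mono_neutral_right) auto
  then show ?thesis using block_pair_block(3)[OF assms(1)] by simp
qed

lemma sum_block_last:
  fixes f :: "'n::{finite,linorder} \<Rightarrow> 'a::comm_monoid_add"
  assumes "odd CARD('n)" "pos p = CARD('n)" "\<And>r. block r \<noteq> block p \<Longrightarrow> f r = 0"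
  shows "(\<Sum>r\<in>UNIV. f r) = f p"
proof -
  have "(\<Sum>r\<in>UNIV. f r) = (\<Sum>r\<in>{p}. f r)"
    using assms(3) block_last[OF assms(1,2)] by (intro sum.mono_neutral_right) auto
  then show ?thesis by simp
qed

section \<open>The unitary matrix of eigenvectors\<close>

lemma Umat_other_block: "block p \<noteq> block q \<Longrightarrow> Umat $ p $ q = 0"
  by (auto simp: Umat_def block_def)

lemma Umat_block_pair:
  fixes p q :: "'n::{finite,linorder}"
  assumes "block_pair \<beta> p q"
  shows "Umat $ p $ p = complex_of_real (sqrt 2 / 2)" "Umat $ p $ q = complex_of_real (sqrt 2 / 2)"
    "Umat $ q $ p = complex_of_real (sqrt 2 / 2) * \<i>" "Umat $ q $ q = - complex_of_real (sqrt 2 / 2) * \<i>"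
proof -
  have "odd CARD('n) \<Longrightarrow> CARD('n) \<noteq> 2 * \<beta>" by auto
  then show "Umat $ p $ p = complex_of_real (sqrt 2 / 2)" "Umat $ p $ q = complex_of_real (sqrt 2 / 2)"
    "Umat $ q $ p = complex_of_real (sqrt 2 / 2) * \<i>" "Umat $ q $ q = - complex_of_real (sqrt 2 / 2) * \<i>"
    using assms by (auto simp: Umat_def block_pair_def)
qed

lemma Umat_last:
  fixes p :: "'n::{finite,linorder}"
  assumes "odd CARD('n)" "pos p = CARD('n)"
  shows "Umat $ p $ p = 1"
  using assms by (simp add: Umat_def)

lemma Umat_diagonal_nonzero: "Umat $ p $ p \<noteq> 0"
  by (cases p rule: index_cases) (auto simp: Umat_block_pair Umat_last)

text \<open>The two columns of a block are proportional to (1, i) and (1, -i), eigenvectors for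
  conjugate eigenvalues. This is what turns the sesquilinear coordinate within a block into a
  bilinear one.\<close>

lemma cnj_Umat:
  assumes "block p = block q" "p \<noteq> q"
  shows "cnj (Umat $ r $ p) = Umat $ r $ q"
proof (cases "block r = block p")
  case True
  show ?thesis
  proof (cases p rule: index_cases)
    case (pair \<beta> p1 p2)
    then have "r = p1 \<or> r = p2" "q = p1 \<or> q = p2"
      using True assms block_pair_block(4) by metis+
    then show ?thesis using pair assms(2) by (auto simp: Umat_block_pair)
  next
    case last
    then show ?thesis using assms block_last by metis
  qed
next
  case False
  then show ?thesis using assms by (simp add: Umat_other_block)
qed

lemma hermitian_transpose_nth [simp]: "hermitian_transpose M $ p $ q = cnj (M $ q $ p)"
  by (simp add: hermitian_transpose_def transpose_def)

lemma Umat_unitary: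
  "hermitian_transpose Umat ** Umat = (mat 1 :: complex^'n::{finite,linorder}^'n::{finite,linorder})"
  "Umat ** hermitian_transpose Umat = (mat 1 :: complex^'n::{finite,linorder}^'n::{finite,linorder})"
proof -
  have half: "complex_of_real (sqrt 2) * complex_of_real (sqrt 2) = 2"
    by (simp flip: of_real_mult)
  have half': "complex_of_real (sqrt 2) * \<i> * (complex_of_real (sqrt 2) * \<i>) = - 2"
    using half by (simp add: mult.assoc mult.left_commute[of \<i>])
  have "(\<Sum>r\<in>UNIV. cnj (Umat $ r $ p) * Umat $ r $ q) = (if p = q then 1 else 0)" for p q :: 'n
  proof (cases "block q = block p")
    case True
    show ?thesis
    proof (cases p rule: index_cases)
      case (pair \<beta> p1 p2)
      have bp: "block p = \<beta>" using pair(2) block_pair_block(1,2)[OF pair(1)] by auto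
      then have "q = p1 \<or> q = p2" using True block_pair_block(4)[OF pair(1)] by metis
      moreover have "(\<Sum>r\<in>UNIV. cnj (Umat $ r $ p) * Umat $ r $ q)
          = cnj (Umat $ p1 $ p) * Umat $ p1 $ q + cnj (Umat $ p2 $ p) * Umat $ p2 $ q"
        using bp by (intro sum_block_pair[OF pair(1)]) (simp add: Umat_other_block)
      ultimately show ?thesis
        using pair block_pair_block(3)[OF pair(1)]
        by (auto simp: Umat_block_pair half half')
    next
      case last
      moreover have "q = p" using last True block_last by blast
      moreover have "(\<Sum>r\<in>UNIV. cnj (Umat $ r $ p) * Umat $ r $ p) = cnj (Umat $ p $ p) * Umat $ p $ p"
        by (intro sum_block_last[OF last]) (simp add: Umat_other_block)
      ultimately show ?thesis by (simp add: Umat_last)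
    qed
  next
    case False
    have "cnj (Umat $ r $ p) * Umat $ r $ q = 0" for r
      using False by (cases "block r = block p") (simp_all add: Umat_other_block)
    then have "(\<Sum>r\<in>UNIV. cnj (Umat $ r $ p) * Umat $ r $ q) = 0" by (intro sum.neutral) blast
    then show ?thesis using False by auto
  qed
  then show *: "hermitian_transpose Umat ** Umat = (mat 1 :: complex^'n::{finite,linorder}^'n::{finite,linorder})"
    by (simp add: matrix_matrix_mult_def mat_def vec_eq_iff)
  then show "Umat ** hermitian_transpose Umat = (mat 1 :: complex^'n::{finite,linorder}^'n::{finite,linorder})"
    by (simp add: matrix_left_right_inverse)
qed

section \<open>Diagonalisation of the commutator map and of its series\<close>

definition lam_matrix :: "(nat \<Rightarrow> real) \<Rightarrow> complex^'n::{finite,linorder}^'n::{finite,linorder}" where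
  "lam_matrix \<Theta> = (\<chi> p q. if p = q then lam \<Theta> q else 0)"

text \<open>The columns of \<open>Umat\<close> are eigenvectors: the block with rows (0, -t) and (t,
  0) maps (1, i) to -it (1, i) and (1, -i) to it (1, -i).\<close>

lemma schur_block_Umat:
  "cmat (schur_block \<Theta> :: real^'n::{finite,linorder}^'n::{finite,linorder}) ** Umat = Umat ** lam_matrix \<Theta>"
proof -
  have schur_other: "schur_block \<Theta> $ p $ q = 0" if "block q \<noteq> block p" for p q :: 'n
    using that by (auto simp: schur_block_def block_def)
  have "(\<Sum>r\<in>UNIV. complex_of_real (schur_block \<Theta> $ p $ r) * Umat $ r $ q) = Umat $ p $ q * lam \<Theta> q"
    for p q :: 'n
  proof (cases p rule: index_cases)
    case (pair \<beta> p1 p2)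
    have blocks: "block p1 = \<beta>" "block p2 = \<beta>" using block_pair_block[OF pair(1)] by auto
    have sum: "(\<Sum>r\<in>UNIV. complex_of_real (schur_block \<Theta> $ p $ r) * Umat $ r $ q)
        = complex_of_real (schur_block \<Theta> $ p $ p1) * Umat $ p1 $ q
          + complex_of_real (schur_block \<Theta> $ p $ p2) * Umat $ p2 $ q"
      using pair(2) blocks by (intro sum_block_pair[OF pair(1)]) (auto simp: schur_other)
    have schur: "schur_block \<Theta> $ p1 $ p1 = 0" "schur_block \<Theta> $ p1 $ p2 = - \<Theta> \<beta>"
      "schur_block \<Theta> $ p2 $ p1 = \<Theta> \<beta>" "schur_block \<Theta> $ p2 $ p2 = 0"
      using pair(1) by (auto simp: schur_block_def block_pair_def)
    have lams: "lam \<Theta> p1 = - \<i> * complex_of_real (\<Theta> \<beta>)" "lam \<Theta> p2 = \<i> * complex_of_real (\<Theta> \<beta>)"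
      using pair(1) by (auto simp: lam_def block_pair_def)
    show ?thesis
    proof (cases "block q = \<beta>")
      case True
      then have "q = p1 \<or> q = p2" using block_pair_block(4)[OF pair(1)] by blast
      then show ?thesis unfolding sum
        using pair by (auto simp: schur lams Umat_block_pair mult.assoc)
    next
      case False
      then have "Umat $ p1 $ q = 0" "Umat $ p2 $ q = 0"
        using blocks by (auto intro: Umat_other_block)
      then show ?thesis unfolding sum using pair(2) by auto
    qed
  next
    case last
    have "(\<Sum>r\<in>UNIV. complex_of_real (schur_block \<Theta> $ p $ r) * Umat $ r $ q)
        = complex_of_real (schur_block \<Theta> $ p $ p) * Umat $ p $ q"
      by (intro sum_block_last[OF last]) (simp add: schur_other)
    moreover have "schur_block \<Theta> $ p $ p = 0" by (simp add: schur_block_def)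
    moreover have "lam \<Theta> p = 0" using last by (simp add: lam_def)
    moreover have "Umat $ p $ q = 0" if "q \<noteq> p"
      using that block_last[OF last] by (intro Umat_other_block) metis
    ultimately show ?thesis by (cases "q = p") auto
  qed
  then show ?thesis
    by (simp add: vec_eq_iff matrix_matrix_mult_def lam_matrix_def if_distrib sum.delta' cong: if_cong)
qed

lemma cmat_mult: "cmat (A ** B) = cmat A ** cmat B"
  by (simp add: vec_eq_iff matrix_matrix_mult_def)

definition eigen_coords :: "real^'n::{finite,linorder}^'n::{finite,linorder} \<Rightarrow> complex^'n::{finite,linorder}^'n::{finite,linorder}" where
  "eigen_coords M = hermitian_transpose Umat ** cmat M ** Umat"

lemma eigen_coords_nth:
  "eigen_coords M $ p $ q =
    (\<Sum>s\<in>UNIV. \<Sum>r\<in>UNIV. cnj (Umat $ r $ p) * complex_of_real (M $ r $ s) * Umat $ s $ q)"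
  by (simp add: eigen_coords_def matrix_matrix_mult_def sum_distrib_right)

lemma cmat_eq_eigen_coords: "cmat M = Umat ** eigen_coords M ** hermitian_transpose Umat"
proof -
  have "Umat ** eigen_coords M ** hermitian_transpose Umat
      = (Umat ** hermitian_transpose Umat) ** cmat M ** (Umat ** hermitian_transpose Umat)"
    by (simp add: eigen_coords_def matrix_mul_assoc)
  then show ?thesis by (simp add: Umat_unitary)
qed

lemma linear_eigen_coords_nth: "linear (\<lambda>M. eigen_coords M $ p $ q)"
proof (rule linearI)
  show "eigen_coords (M + N) $ p $ q = eigen_coords M $ p $ q + eigen_coords N $ p $ q" for M N
    by (simp only: eigen_coords_nth vector_add_component of_real_add distrib_left distrib_right sum.distrib)
  show "eigen_coords (c *\<^sub>R M) $ p $ q = c *\<^sub>R eigen_coords M $ p $ q" for c M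
    unfolding eigen_coords_nth scaleR_sum_right
    by (intro sum.cong refl)
      (simp only: vector_scaleR_component real_scaleR_def of_real_mult
        scaleR_conv_of_real[where 'a = complex] mult_ac)
qed

lemma eigen_coords_commutator_map:
  fixes M :: "real^'n::{finite,linorder}^'n::{finite,linorder}"
  shows "eigen_coords (commutator_map (schur_block \<Theta>) M) $ p $ q
    = (lam \<Theta> q - lam \<Theta> p) * eigen_coords M $ p $ q"
proof -
  let ?H = "hermitian_transpose (Umat :: complex^'n::{finite,linorder}^'n::{finite,linorder})"
  let ?S = "schur_block \<Theta> :: real^'n::{finite,linorder}^'n::{finite,linorder}"
  have "eigen_coords (M ** ?S) = ?H ** cmat M ** (cmat ?S ** Umat)"
    by (simp add: eigen_coords_def cmat_mult matrix_mul_assoc)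
  also have "\<dots> = eigen_coords M ** lam_matrix \<Theta>"
    by (simp add: schur_block_Umat eigen_coords_def matrix_mul_assoc)
  finally have right: "eigen_coords (M ** ?S) $ p $ q = eigen_coords M $ p $ q * lam \<Theta> q"
    by (simp add: matrix_matrix_mult_def lam_matrix_def if_distrib[of "\<lambda>x. _ * x"] sum.delta' cong: if_cong)
  \<comment> \<open>Inserting \<open>Umat ** ?H = mat 1\<close> turns the relation for right
    eigenvectors into the one for left eigenvectors.\<close>
  have "?H ** cmat ?S = ?H ** (cmat ?S ** Umat) ** ?H"
    by (simp add: Umat_unitary flip: matrix_mul_assoc)
  also have "\<dots> = lam_matrix \<Theta> ** ?H"
    by (simp add: schur_block_Umat matrix_mul_assoc Umat_unitary)
  finally have "?H ** cmat ?S = lam_matrix \<Theta> ** ?H" .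
  moreover have "eigen_coords (?S ** M) = (?H ** cmat ?S) ** cmat M ** Umat"
    by (simp add: eigen_coords_def cmat_mult matrix_mul_assoc)
  ultimately have "eigen_coords (?S ** M) = lam_matrix \<Theta> ** eigen_coords M"
    by (simp add: eigen_coords_def matrix_mul_assoc)
  then have left: "eigen_coords (?S ** M) $ p $ q = lam \<Theta> p * eigen_coords M $ p $ q"
    by (simp add: matrix_matrix_mult_def lam_matrix_def if_distrib[of "\<lambda>x. x * _"] sum.delta cong: if_cong)
  show ?thesis
    unfolding commutator_map_def linear_diff[OF linear_eigen_coords_nth] right left
    by (simp add: algebra_simps)
qed

text \<open>This is the exponential series without its constant term, divided by \<open>z\<close>.
  At \<open>z = 0\<close> only the leading 1 remains, which is the case distinction in
  \<open>Phi\<close>.\<close>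

lemma exp_minus_1_div_sums:
  "(\<lambda>k. z ^ k / fact (Suc k)) sums (if z = 0 then 1 else (exp z - 1) / z)" for z :: complex
proof (cases "z = 0")
  case True
  then show ?thesis using powser_sums_zero[of "\<lambda>k. 1 / fact (Suc k) :: complex"] by simp
next
  case False
  have "(\<lambda>k. z ^ k /\<^sub>R fact k) sums exp z" by (rule exp_converges)
  then have "(\<lambda>k. z ^ Suc k /\<^sub>R fact (Suc k)) sums (exp z - 1)"
    by (subst sums_Suc_iff) simp
  then have "(\<lambda>k. z ^ Suc k /\<^sub>R fact (Suc k) / z) sums ((exp z - 1) / z)"
    by (rule sums_divide)
  also have "(\<lambda>k. z ^ Suc k /\<^sub>R fact (Suc k) / z) = (\<lambda>k. z ^ k / fact (Suc k))"
    using False by (simp add: fun_eq_iff scaleR_conv_of_real divide_simps del: fact_Suc)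
  finally show ?thesis using False by simp
qed

text \<open>Each coordinate is a continuous linear functional that \<open>commutator_map\<close>
  merely rescales, so it passes through the series and leaves a scalar power series.\<close>

lemma eigen_coords_dexp_factor:
  "eigen_coords (dexp_factor (schur_block \<Theta>) M) $ p $ q = Phi \<Theta> $ p $ q * eigen_coords M $ p $ q"
proof -
  let ?C = "commutator_map (schur_block \<Theta>)" and ?d = "lam \<Theta> q - lam \<Theta> p"
  have pow: "eigen_coords ((?C ^^ k) M) $ p $ q = ?d ^ k * eigen_coords M $ p $ q" for k
    by (induction k) (simp_all add: eigen_coords_commutator_map)
  have "(\<lambda>k. eigen_coords ((1 / fact (Suc k)) *\<^sub>R (?C ^^ k) M) $ p $ q)
      sums (eigen_coords (dexp_factor (schur_block \<Theta>) M) $ p $ q)"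
    using linear_eigen_coords_nth dexp_factor_sums
    by (intro bounded_linear.sums[of "\<lambda>M. eigen_coords M $ p $ q"])
       (simp_all add: linear_conv_bounded_linear)
  moreover have "eigen_coords ((1 / fact (Suc k)) *\<^sub>R (?C ^^ k) M) $ p $ q
      = ?d ^ k / fact (Suc k) * eigen_coords M $ p $ q" for k
    by (simp add: linear_scale[OF linear_eigen_coords_nth] pow
        scaleR_conv_of_real[where 'a = complex] del: fact_Suc)
  ultimately have "(\<lambda>k. ?d ^ k / fact (Suc k) * eigen_coords M $ p $ q)
      sums (eigen_coords (dexp_factor (schur_block \<Theta>) M) $ p $ q)" by simp
  moreover have "(\<lambda>k. ?d ^ k / fact (Suc k) * eigen_coords M $ p $ q)
      sums ((if ?d = 0 then 1 else (exp ?d - 1) / ?d) * eigen_coords M $ p $ q)"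
    by (intro sums_mult2 exp_minus_1_div_sums)
  ultimately have "eigen_coords (dexp_factor (schur_block \<Theta>) M) $ p $ q
      = (if ?d = 0 then 1 else (exp ?d - 1) / ?d) * eigen_coords M $ p $ q"
    by (rule sums_unique2)
  then show ?thesis by (simp add: Phi_def eq_commute[of "lam \<Theta> p"])
qed

text \<open>Besides identifying the two maps, this shows that the complex formula for the core map
  yields real matrices.\<close>

lemma core_map_eq_dexp_factor: "core_map \<Theta> M = cmat (dexp_factor (schur_block \<Theta>) M)"
proof -
  have "hadamard (eigen_coords M) (Phi \<Theta>) = eigen_coords (dexp_factor (schur_block \<Theta>) M)"
    by (simp add: vec_eq_iff hadamard_def eigen_coords_dexp_factor mult.commute)
  then show ?thesis
    unfolding core_map_def eigen_coords_def[symmetric]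
      cmat_eq_eigen_coords[of "dexp_factor (schur_block \<Theta>) M"] by simp
qed

section \<open>Bijectivity on the skew-symmetric matrices\<close>

lemma schur_block_Skew: "(schur_block \<Theta> :: real^'n::{finite,linorder}^'n::{finite,linorder}) \<in> Skew"
proof -
  let ?S = "schur_block \<Theta> :: real^'n::{finite,linorder}^'n::{finite,linorder}"
  have "transpose ?S $ p $ q = (- ?S) $ p $ q" for p q
  proof -
    consider "odd (pos p)" "pos q = pos p + 1" | "even (pos p)" "pos p = pos q + 1"
      | "\<not> (odd (pos p) \<and> pos q = pos p + 1)" "\<not> (even (pos p) \<and> pos p = pos q + 1)" by blast
    then show ?thesis
    proof cases
      case 3
      then have "\<not> (odd (pos q) \<and> pos p = pos q + 1)" "\<not> (even (pos q) \<and> pos q = pos p + 1)"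
        by auto
      with 3 show ?thesis
        by (simp only: schur_block_def transpose_def vec_lambda_beta if_False vector_uminus_component minus_zero)
    qed (simp_all add: schur_block_def transpose_def)
  qed
  then show ?thesis unfolding Skew_iff vec_eq_iff by blast
qed

lemma bij_betw_core_map_iff:
  "bij_betw (core_map \<Theta>) (Skew :: (real^'n::{finite,linorder}^'n::{finite,linorder}) set) (cmat ` Skew)
    \<longleftrightarrow> bij_betw (dexp_factor (schur_block \<Theta> :: real^'n::{finite,linorder}^'n::{finite,linorder})) Skew Skew"
proof -
  have "inj (cmat :: real^'n::{finite,linorder}^'n::{finite,linorder} \<Rightarrow> _)"
    by (simp add: inj_def vec_eq_iff)
  then have cmat: "bij_betw (cmat :: real^'n::{finite,linorder}^'n::{finite,linorder} \<Rightarrow> _) Skew (cmat ` Skew)"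
    by (simp add: bij_betw_def inj_on_subset[OF _ subset_UNIV])
  let ?f = "dexp_factor (schur_block \<Theta> :: real^'n::{finite,linorder}^'n::{finite,linorder})"
  have "core_map \<Theta> = cmat \<circ> ?f"
    by (simp add: fun_eq_iff core_map_eq_dexp_factor)
  moreover have "?f ` Skew \<subseteq> Skew" using dexp_factor_Skew[OF schur_block_Skew] by blast
  ultimately show ?thesis using bij_betw_comp_iff2[OF cmat] by metis
qed

text \<open>Within a \<open>2 \<times> 2\<close> block the two eigenvectors are conjugate, so the coordinate is \<open>v\<^sup>T M v\<close>.\<close>

lemma eigen_coords_same_block:
  assumes M: "M \<in> Skew" and "block p = block q" "p \<noteq> q"
  shows "eigen_coords M $ p $ q = 0"
proof -
  have anti: "M $ s $ r = - (M $ r $ s)" for r s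
    using M[unfolded Skew_iff, THEN arg_cong, of "\<lambda>X. X $ r $ s"] by (simp add: transpose_def)
  let ?f = "\<lambda>r s. Umat $ r $ q * complex_of_real (M $ r $ s) * Umat $ s $ q"
  have eq: "eigen_coords M $ p $ q = (\<Sum>s\<in>UNIV. \<Sum>r\<in>UNIV. ?f r s)"
    using assms by (simp add: eigen_coords_nth cnj_Umat)
  also have "\<dots> = (\<Sum>s\<in>UNIV. \<Sum>r\<in>UNIV. ?f s r)" by (rule sum.swap)
  also have "\<dots> = (\<Sum>s\<in>UNIV. \<Sum>r\<in>UNIV. - ?f r s)"
  proof (intro sum.cong refl)
    show "?f s r = - ?f r s" for r s by (simp add: anti[of r s])
  qed
  also have "\<dots> = - eigen_coords M $ p $ q" by (simp only: sum_negf eq)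
  finally show ?thesis by simp
qed

text \<open>Zeros of \<open>Phi\<close> inside a block do no harm: an angle equal to pi produces
  one, but the matching coordinate of a skew matrix vanishes anyway.\<close>

lemma bij_betw_dexp_factor_schur_block_iff:
  "bij_betw (dexp_factor (schur_block \<Theta>)) Skew (Skew :: (real^'n::{finite,linorder}^'n::{finite,linorder}) set)
    \<longleftrightarrow> (\<forall>p q :: 'n::{finite,linorder}. block p \<noteq> block q \<longrightarrow> Phi \<Theta> $ p $ q \<noteq> 0)"
proof (intro iffI allI impI notI)
  fix p q :: 'n
  assume bij: "bij_betw (dexp_factor (schur_block \<Theta>)) Skew (Skew :: (real^'n::{finite,linorder}^'n::{finite,linorder}) set)"
    and pq: "block p \<noteq> block q" and Phi: "Phi \<Theta> $ p $ q = 0"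
  \<comment> \<open>\<open>N\<close> is the elementary skew matrix on the index pair
    \<open>p\<close>, \<open>q\<close>. As \<open>Umat\<close> vanishes between different blocks,
    its \<open>p\<close>, \<open>q\<close> coordinate is a product of nonzero diagonal entries (one
    conjugated), so \<open>N\<close> cannot lie in the image.\<close>
  define N :: "real^'n::{finite,linorder}^'n::{finite,linorder}" where
    "N = (\<chi> r s. (if r = p then if s = q then 1 else 0 else 0) - (if r = q then if s = p then 1 else 0 else 0))"
  have "p \<noteq> q" using pq by auto
  then have "N \<in> Skew" by (simp add: Skew_iff vec_eq_iff transpose_def N_def)
  then obtain M where "N = dexp_factor (schur_block \<Theta>) M"
    using bij by (auto simp: bij_betw_def)
  then have "eigen_coords N $ p $ q = 0" by (simp add: eigen_coords_dexp_factor Phi)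
  moreover have "eigen_coords N $ p $ q = cnj (Umat $ p $ p) * Umat $ q $ q - cnj (Umat $ q $ p) * Umat $ p $ q"
  proof -
    have "cnj (Umat $ r $ p) * complex_of_real (N $ r $ s) * Umat $ s $ q
        = (if r = p then if s = q then cnj (Umat $ p $ p) * Umat $ q $ q else 0 else 0)
          - (if r = q then if s = p then cnj (Umat $ q $ p) * Umat $ p $ q else 0 else 0)" for r s
      using \<open>p \<noteq> q\<close> by (simp add: N_def)
    then show ?thesis
      by (simp add: eigen_coords_nth sum_subtractf sum.delta)
  qed
  ultimately show False
    using pq by (simp add: Umat_other_block Umat_diagonal_nonzero)
next
  assume Phi: "\<forall>p q :: 'n. block p \<noteq> block q \<longrightarrow> Phi \<Theta> $ p $ q \<noteq> 0"
  show "bij_betw (dexp_factor (schur_block \<Theta>)) Skew (Skew :: (real^'n::{finite,linorder}^'n::{finite,linorder}) set)"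
  proof (rule linear_bij_betw_subspace[OF linear_dexp_factor subspace_Skew])
    fix M :: "real^'n::{finite,linorder}^'n::{finite,linorder}"
    assume M: "M \<in> Skew" and "dexp_factor (schur_block \<Theta>) M = 0"
    moreover have "eigen_coords (0 :: real^'n::{finite,linorder}^'n::{finite,linorder}) $ p $ q = 0" for p q
      by (simp add: eigen_coords_nth)
    ultimately have "Phi \<Theta> $ p $ q * eigen_coords M $ p $ q = 0" for p q
      using eigen_coords_dexp_factor[of \<Theta> M p q] by metis
    moreover have "Phi \<Theta> $ p $ p \<noteq> 0" for p :: 'n by (simp add: Phi_def)
    ultimately have "eigen_coords M $ p $ q = 0" for p q :: 'n
      using Phi eigen_coords_same_block[OF M] by (metis mult_eq_0_iff)
    then have "eigen_coords M = 0" by (simp add: vec_eq_iff)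
    then have "cmat M = 0" 
      by (subst cmat_eq_eigen_coords) (simp add: matrix_matrix_mult_def vec_eq_iff)
    then show "M = 0" by (simp add: vec_eq_iff)
  qed (use dexp_factor_Skew[OF schur_block_Skew] in auto)
qed

section \<open>From the zeros of \<open>Phi\<close> to the conditions on the angles\<close>

definition signed_angle :: "(nat \<Rightarrow> real) \<Rightarrow> 'n::{finite,linorder} \<Rightarrow> real" where
  "signed_angle \<Theta> p = Im (lam \<Theta> p)"

lemma lam_signed_angle: "lam \<Theta> p = \<i> * complex_of_real (signed_angle \<Theta> p)"
  by (simp add: signed_angle_def lam_def)

lemma signed_angle_block_pair:
  assumes "block_pair \<beta> p q"
  shows "signed_angle \<Theta> p = - \<Theta> \<beta>" "signed_angle \<Theta> q = \<Theta> \<beta>"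
  using assms by (auto simp: signed_angle_def lam_def block_pair_def)

lemma signed_angle_last:
  fixes p :: "'n::{finite,linorder}"
  assumes "odd CARD('n)" "pos p = CARD('n)"
  shows "signed_angle \<Theta> p = 0"
  using assms by (simp add: signed_angle_def lam_def)

text \<open>The value 0 counts as nonresonant, in accordance with \<open>Phi\<close> being 1 for
  equal eigenvalues.\<close>

definition nonresonant :: "real \<Rightarrow> bool" where
  "nonresonant x \<longleftrightarrow> (\<forall>l::int. l \<noteq> 0 \<longrightarrow> x \<noteq> 2 * of_int l * pi)"

lemma nonresonant_uminus: "nonresonant (- x) \<longleftrightarrow> nonresonant x"
proof -
  have "nonresonant (- x)" if "nonresonant x" for x
    unfolding nonresonant_def
  proof (intro allI impI notI)
    fix l :: int assume "l \<noteq> 0" "- x = 2 * of_int l * pi"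
    then have "- l \<noteq> 0" "x = 2 * of_int (- l) * pi" by auto
    with that show False unfolding nonresonant_def by blast
  qed
  from this[of x] this[of "- x"] show ?thesis by auto
qed

text \<open>The eigenvalues are imaginary, so a zero of \<open>Phi\<close> means that e^(ix) = 1 for
  the nonzero difference x of signed angles, hence that x is a nonzero multiple of 2 pi.\<close>

lemma Phi_nonzero_iff:
  "Phi \<Theta> $ p $ q \<noteq> 0 \<longleftrightarrow> nonresonant (signed_angle \<Theta> q - signed_angle \<Theta> p)"
proof -
  let ?x = "signed_angle \<Theta> q - signed_angle \<Theta> p"
  have d: "lam \<Theta> q - lam \<Theta> p = \<i> * complex_of_real ?x"
    by (simp add: lam_signed_angle algebra_simps)
  have "lam \<Theta> p = lam \<Theta> q \<longleftrightarrow> ?x = 0" by (auto simp: lam_signed_angle)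
  moreover have "exp (lam \<Theta> q - lam \<Theta> p) = 1 \<longleftrightarrow> (\<exists>l::int. ?x = 2 * of_int l * pi)"
    unfolding d exp_eq_1 by simp
  moreover have "(\<exists>l::int. ?x = 2 * of_int l * pi) \<longleftrightarrow> ?x = 0 \<or> \<not> nonresonant ?x"
    unfolding nonresonant_def by (metis mult_zero_left mult_zero_right of_int_0)
  moreover have "?x = 0 \<Longrightarrow> nonresonant ?x" by (simp add: nonresonant_def)
  ultimately show ?thesis by (auto simp: Phi_def)
qed

text \<open>Differences of signed angles between two 2 x 2 blocks are, up to sign, the sum and the
  difference of the two angles. For odd n the last index has signed angle 0 and contributes the
  conditions on single angles.\<close>

lemma angle_condition_iff:
  "angle_condition CARD('n) \<Theta>
    \<longleftrightarrow> (\<forall>p q :: 'n::{finite,linorder}. block p \<noteq> block q \<longrightarrow> Phi \<Theta> $ p $ q \<noteq> 0)"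
  (is "?L \<longleftrightarrow> ?R")
proof -
  let ?n = "CARD('n)"
  have cond: "?L \<longleftrightarrow>
      (\<forall>i\<in>{1..?n div 2}. \<forall>j\<in>{1..?n div 2}. j < i \<longrightarrow> nonresonant (\<Theta> i + \<Theta> j) \<and> nonresonant (\<Theta> i - \<Theta> j))
      \<and> (odd ?n \<longrightarrow> (\<forall>j\<in>{1..?n div 2}. nonresonant (\<Theta> j)))"
    unfolding angle_condition_def nonresonant_def by blast
  show ?thesis
  proof
    assume R: ?R
    show ?L unfolding cond
    proof (intro conjI ballI impI)
      fix i j assume "i \<in> {1..?n div 2}" "j \<in> {1..?n div 2}" "j < i"
      then obtain i1 i2 j1 j2 :: 'n where pairs: "block_pair i i1 i2" "block_pair j j1 j2"
        using ex_block_pair[of i, where 'n = 'n] ex_block_pair[of j, where 'n = 'n] by auto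
      \<comment> \<open>The second index of block \<open>i\<close> carries the angle itself; paired
        with the first and the second index of block \<open>j\<close> it yields the sum and the
        difference.\<close>
      have "block i2 \<noteq> block j1" "block i2 \<noteq> block j2"
        using \<open>j < i\<close> block_pair_block(2)[OF pairs(1)] block_pair_block(1,2)[OF pairs(2)] by auto
      with R have "nonresonant (signed_angle \<Theta> i2 - signed_angle \<Theta> j1)"
        "nonresonant (signed_angle \<Theta> i2 - signed_angle \<Theta> j2)"
        using Phi_nonzero_iff by metis+
      then show "nonresonant (\<Theta> i + \<Theta> j)" "nonresonant (\<Theta> i - \<Theta> j)"
        using pairs by (simp_all add: signed_angle_block_pair)
    next
      fix j assume odd: "odd ?n" and j: "j \<in> {1..?n div 2}"
      then obtain j1 j2 :: 'n where pair: "block_pair j j1 j2"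
        using ex_block_pair[of j, where 'n = 'n] by auto
      obtain z :: 'n where z: "pos z = ?n" using ex_pos_eq[of ?n, where 'n = 'n] by auto
      have "block z \<noteq> block j2"
        using block_last[OF odd z] block_pair_block[OF pair] by metis
      with R have "nonresonant (signed_angle \<Theta> j2 - signed_angle \<Theta> z)"
        using Phi_nonzero_iff by metis
      then show "nonresonant (\<Theta> j)"
        using signed_angle_block_pair[OF pair] signed_angle_last[OF odd z] by simp
    qed
  next
    assume L: ?L
    have range: "\<beta> \<in> {1..?n div 2}" if "block_pair \<beta> p1 p2" for \<beta> and p1 p2 :: 'n
      using that by (auto simp: block_pair_def)
    \<comment> \<open>Nonresonance is even in its argument, which removes the ordering
      \<open>j < i\<close> of the angle condition.\<close>
    have both: "nonresonant (\<Theta> i + \<Theta> j) \<and> nonresonant (\<Theta> i - \<Theta> j)"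
      if "i \<in> {1..?n div 2}" "j \<in> {1..?n div 2}" "i \<noteq> j" for i j
    proof (cases "j < i")
      case True
      then show ?thesis using L that unfolding cond by blast
    next
      case False
      then have "nonresonant (\<Theta> j + \<Theta> i)" "nonresonant (\<Theta> j - \<Theta> i)"
        using L that unfolding cond by force+
      then show ?thesis using nonresonant_uminus[of "\<Theta> j - \<Theta> i"] by (simp add: add.commute)
    qed
    show ?R
    proof (intro allI impI)
      fix p q :: 'n assume pq: "block p \<noteq> block q"
      show "Phi \<Theta> $ p $ q \<noteq> 0" unfolding Phi_nonzero_iff
      proof (cases p rule: index_cases; cases q rule: index_cases)
        fix i j and p1 p2 q1 q2 :: 'n
        assume i: "block_pair i p1 p2" "p = p1 \<or> p = p2" and j: "block_pair j q1 q2" "q = q1 \<or> q = q2"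
        have "i \<noteq> j" using pq i j by (metis block_pair_block(1,2))
        then have "nonresonant (\<Theta> i + \<Theta> j)" "nonresonant (\<Theta> i - \<Theta> j)"
          using both range i(1) j(1) by blast+
        moreover have "- \<Theta> j - \<Theta> i = - (\<Theta> i + \<Theta> j)" "\<Theta> j - \<Theta> i = - (\<Theta> i - \<Theta> j)"
          by simp_all
        ultimately have "nonresonant (- \<Theta> j - \<Theta> i)" "nonresonant (\<Theta> j - \<Theta> i)"
          "nonresonant (\<Theta> i + \<Theta> j)" "nonresonant (\<Theta> i - \<Theta> j)"
          by (simp_all only: nonresonant_uminus)
        then show "nonresonant (signed_angle \<Theta> q - signed_angle \<Theta> p)"
          using i j by (auto simp: signed_angle_block_pair add.commute)
      next
        fix i and p1 p2 :: 'n
        assume i: "block_pair i p1 p2" "p = p1 \<or> p = p2" and last: "odd ?n" "pos q = ?n"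
        then have "nonresonant (\<Theta> i)" using L range unfolding cond by blast
        then show "nonresonant (signed_angle \<Theta> q - signed_angle \<Theta> p)"
          using i signed_angle_last[OF last] nonresonant_uminus[of "\<Theta> i"]
          by (auto simp: signed_angle_block_pair)
      next
        fix j and q1 q2 :: 'n
        assume j: "block_pair j q1 q2" "q = q1 \<or> q = q2" and last: "odd ?n" "pos p = ?n"
        then have "nonresonant (\<Theta> j)" using L range unfolding cond by blast
        then show "nonresonant (signed_angle \<Theta> q - signed_angle \<Theta> p)"
          using j signed_angle_last[OF last] nonresonant_uminus[of "\<Theta> j"]
          by (auto simp: signed_angle_block_pair)
      next
        \<comment> \<open>Both indices are the last one, contradicting that their blocks
          differ.\<close>
        assume "pos p = ?n" "pos q = ?n"
        then show "nonresonant (signed_angle \<Theta> q - signed_angle \<Theta> p)"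
          using pq by (metis pos_eq_iff)
      qed
    qed
  qed
qed

theorem theorem3p8:
  fixes A Q :: "real^'n::{finite,linorder}^'n::{finite,linorder}" and \<Theta> :: "nat \<Rightarrow> real"
  assumes "CARD('n) \<ge> 2" and "A \<in> Skew" and "has_angles A \<Theta>" and "Q = mexp A"
  shows "(bij_betw (core_map \<Theta>) (Skew :: (real^'n::{finite,linorder}^'n::{finite,linorder}) set)
            (map_matrix complex_of_real ` Skew)
            \<longleftrightarrow> angle_condition CARD('n) \<Theta>) \<and>
         (bij_betw (Dexp A) Skew (tangent_SO Q) \<longleftrightarrow> angle_condition CARD('n) \<Theta>)"
proof -
  have factor: "bij_betw (dexp_factor (schur_block \<Theta> :: real^'n::{finite,linorder}^'n::{finite,linorder})) Skew Skew
      \<longleftrightarrow> angle_condition CARD('n) \<Theta>"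
    unfolding bij_betw_dexp_factor_schur_block_iff angle_condition_iff ..
  obtain R where R: "orthogonal_matrix R" and A: "A = R ** schur_block \<Theta> ** transpose R"
    using assms(3) unfolding has_angles_def by blast
  have "bij_betw (Dexp A) Skew (tangent_SO Q) \<longleftrightarrow> bij_betw (dexp_factor A) Skew Skew"
    unfolding assms(4) by (rule bij_betw_Dexp_iff[OF assms(2)])
  \<comment> \<open>Passing to the Schur form removes \<open>R\<close>, so both maps are governed by
    the same operator \<open>dexp_factor (schur_block \<Theta>)\<close>.\<close>
  also have "\<dots> \<longleftrightarrow> bij_betw (dexp_factor (schur_block \<Theta> :: real^'n::{finite,linorder}^'n::{finite,linorder})) Skew Skew"
    unfolding A by (rule bij_betw_dexp_factor_conjugate[OF R schur_block_Skew])
  finally show ?thesis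
    using factor bij_betw_core_map_iff by blast
qed

end
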